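(* Let $n\ge3$, let $t$ be an indeterminate, let $v(t)$ be an invertible element of $\mathbb{Z}[t^{\pm1}]$, and let $\eta_1':VST_n\to\mathrm{GL}_n(\mathbb{Z}[t^{\pm1}])$ be the representation of the virtual singular twin group given, for $1\le i\le n-1$, by $$\eta_1'(s_i)=\begin{pmatrix} I_{i-1}&0&0&0\\0&1-t&t&0\\0&2-t&t-1&0\\0&0&0&I_{n-i-1}\end{pmatrix},\qquad \eta_1'(\tau_i)=I_n,\qquad \eta_1'(\nu_i)=\begin{pmatrix} I_{i-1}&0&0&0\\0&0&v(t)&0\\0&\frac{1}{v(t)}&0&0\\0&0&0&I_{n-i-1}\end{pmatrix}.$$ Then $\eta_1'$ is unfaithful (that is, not injective).
   Context: The virtual singular twin group $VST_n$ is the group generated by $s_i,\tau_i,\nu_i$ ($1\le i\le n-1$) subject to: $s_i^2=1$, $\nu_i^2=1$ and $\tau_is_i=s_i\tau_i$ for all $i$; $s_is_j\tau_i=\tau_js_is_j$, $\nu_i\nu_j\nu_i=\nu_j\nu_i\nu_j$, $\nu_is_j\nu_i=\nu_js_i\nu_j$, $\nu_i\tau_j\nu_i=\nu_j\tau_i\nu_j$ for $|i-j|=1$; and $g_ih_j=h_jg_i$ for $|i-j|\ge 2$, where $g_i,h_i\in\{s_i,\tau_i,\nu_i\}$. $I_r$ is the $r\times r$ identity matrix. *)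

theory Defs
  imports
    "HOL-Library.Poly_Mapping"
    "HOL-Algebra.Coset"
    "Jordan_Normal_Form.Matrix"
begin

text \<open>
  Groups given by generators and relations. A signed word is a list of pairs \<open>(x, b)\<close>, where
  \<open>(x, True)\<close> stands for the generator \<open>x\<close> and \<open>(x, False)\<close> for its formal inverse. A relation
  is a pair of positive words. The presented group consists of the classes of signed words modulo
  the least congruence that contains free cancellation and the relations.
\<close>

abbreviation signed_words :: "'g set \<Rightarrow> ('g \<times> bool) list set" where
  "signed_words X \<equiv> lists (X \<times> UNIV)"

definition positive :: "'g list \<Rightarrow> ('g \<times> bool) list" where
  "positive w = map (\<lambda>x. (x, True)) w"

inductive pres_cong ::
  "'g set \<Rightarrow> ('g list \<times> 'g list) set \<Rightarrow> ('g \<times> bool) list \<Rightarrow> ('g \<times> bool) list \<Rightarrow> bool"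
  for X :: "'g set" and R :: "('g list \<times> 'g list) set" where
  pres_refl: "u \<in> signed_words X \<Longrightarrow> pres_cong X R u u"
| pres_sym: "pres_cong X R u v \<Longrightarrow> pres_cong X R v u"
| pres_trans: "pres_cong X R u v \<Longrightarrow> pres_cong X R v w \<Longrightarrow> pres_cong X R u w"
| pres_append: "pres_cong X R u u' \<Longrightarrow> pres_cong X R v v' \<Longrightarrow> pres_cong X R (u @ v) (u' @ v')"
| pres_cancel: "x \<in> X \<Longrightarrow> pres_cong X R [(x, b), (x, \<not> b)] []"
| pres_relation: "(u, v) \<in> R \<Longrightarrow> u \<in> lists X \<Longrightarrow> v \<in> lists X \<Longrightarrow> pres_cong X R (positive u) (positive v)"

definition pres_class ::
  "'g set \<Rightarrow> ('g list \<times> 'g list) set \<Rightarrow> ('g \<times> bool) list \<Rightarrow> ('g \<times> bool) list set" where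
  "pres_class X R u = {v. pres_cong X R u v}"

definition presented_group ::
  "'g set \<Rightarrow> ('g list \<times> 'g list) set \<Rightarrow> ('g \<times> bool) list set monoid" where
  "presented_group X R =
    \<lparr>carrier = pres_class X R ` signed_words X,
     monoid.mult = (\<lambda>A B. \<Union>u\<in>A. \<Union>v\<in>B. pres_class X R (u @ v)),
     monoid.one = pres_class X R []\<rparr>"

lemma pres_cong_words:
  "pres_cong X R u v \<Longrightarrow> u \<in> signed_words X \<and> v \<in> signed_words X"
  by (induction rule: pres_cong.induct) (auto simp: positive_def)

lemma pres_class_eqI: "pres_cong X R u v \<Longrightarrow> pres_class X R u = pres_class X R v"
  unfolding pres_class_def
  by (rule Collect_cong) (rule iffI, erule pres_trans[OF pres_sym], assumption,
      erule pres_trans, assumption)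

lemma presented_group_mult:
  assumes "u \<in> signed_words X" "v \<in> signed_words X"
  shows "pres_class X R u \<otimes>\<^bsub>presented_group X R\<^esub> pres_class X R v = pres_class X R (u @ v)"
proof -
  let ?U = "pres_class X R u" and ?V = "pres_class X R v"
  have nonempty: "u \<in> ?U" "v \<in> ?V"
    using assms by (auto simp: pres_class_def intro: pres_refl)
  have "(\<Union>u'\<in>?U. \<Union>v'\<in>?V. pres_class X R (u' @ v')) =
      (\<Union>u'\<in>?U. \<Union>v'\<in>?V. pres_class X R (u @ v))"
  proof (rule SUP_cong[OF refl SUP_cong[OF refl]])
    fix u' v' assume "u' \<in> ?U" "v' \<in> ?V"
    then show "pres_class X R (u' @ v') = pres_class X R (u @ v)"
      by (intro pres_class_eqI pres_sym[OF pres_append]) (simp_all add: pres_class_def)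
  qed
  also have "(\<Union>u'\<in>?U. \<Union>v'\<in>?V. pres_class X R (u @ v)) = pres_class X R (u @ v)"
    using nonempty by blast
  finally show ?thesis
    by (simp add: presented_group_def)
qed

lemma pres_cong_inverse:
  "u \<in> signed_words X \<Longrightarrow> pres_cong X R (rev (map (\<lambda>(x, b). (x, \<not> b)) u) @ u) []"
proof (induction u)
  case Nil
  show ?case by (simp add: pres_refl)
next
  case (Cons a u)
  obtain x b where a: "a = (x, b)" by (cases a)
  let ?inv = "rev (map (\<lambda>(x, b). (x, \<not> b)) u)"
  from Cons.prems a have x: "x \<in> X" and u: "u \<in> signed_words X" by auto
  from u have inv: "?inv \<in> signed_words X" by (auto simp: in_lists_conv_set)
  have "pres_cong X R [(x, \<not> b), (x, b)] []"
    using pres_cancel[OF x, of R "\<not> b"] by simp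
  then have "pres_cong X R (?inv @ [(x, \<not> b), (x, b)] @ u) (?inv @ [] @ u)"
    by (intro pres_append pres_refl inv u)
  then show ?case
    using pres_trans[OF _ Cons.IH[OF u]] a by simp
qed

lemma presented_group_is_group: "group (presented_group X R)"
proof (rule groupI)
  let ?G = "presented_group X R"
  have carrier: "carrier ?G = pres_class X R ` signed_words X"
    and one: "\<one>\<^bsub>?G\<^esub> = pres_class X R []"
    by (simp_all add: presented_group_def)
  show "\<one>\<^bsub>?G\<^esub> \<in> carrier ?G" unfolding carrier one by blast
  fix A assume "A \<in> carrier ?G"
  then obtain u where u: "u \<in> signed_words X" "A = pres_class X R u" unfolding carrier by blast
  show "\<one>\<^bsub>?G\<^esub> \<otimes>\<^bsub>?G\<^esub> A = A"
    using presented_group_mult[of "[]" X u R] u unfolding one by simp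
  let ?inv = "rev (map (\<lambda>(x, b). (x, \<not> b)) u)"
  have inv: "?inv \<in> signed_words X" using u(1) by (auto simp: in_lists_conv_set)
  have "pres_class X R ?inv \<otimes>\<^bsub>?G\<^esub> A = \<one>\<^bsub>?G\<^esub>"
    unfolding one u(2) presented_group_mult[OF inv u(1)]
    by (rule pres_class_eqI[OF pres_cong_inverse[OF u(1)]])
  then show "\<exists>B\<in>carrier ?G. B \<otimes>\<^bsub>?G\<^esub> A = \<one>\<^bsub>?G\<^esub>" unfolding carrier using inv by blast
  fix B assume "B \<in> carrier ?G"
  then obtain v where v: "v \<in> signed_words X" "B = pres_class X R v" unfolding carrier by blast
  have uv: "u @ v \<in> signed_words X" using u(1) v(1) by auto
  show "A \<otimes>\<^bsub>?G\<^esub> B \<in> carrier ?G"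
    unfolding carrier u(2) v(2) presented_group_mult[OF u(1) v(1)] using uv by blast
  fix C assume "C \<in> carrier ?G"
  then obtain w where w: "w \<in> signed_words X" "C = pres_class X R w" unfolding carrier by blast
  have vw: "v @ w \<in> signed_words X" using v(1) w(1) by auto
  show "A \<otimes>\<^bsub>?G\<^esub> B \<otimes>\<^bsub>?G\<^esub> C = A \<otimes>\<^bsub>?G\<^esub> (B \<otimes>\<^bsub>?G\<^esub> C)"
    unfolding u(2) v(2) w(2) presented_group_mult[OF u(1) v(1)] presented_group_mult[OF v(1) w(1)]
      presented_group_mult[OF uv w(1)] presented_group_mult[OF u(1) vw] by simp
qed

datatype vst_gen = Sg nat | Tau nat | Nu nat

definition vst_gens :: "nat \<Rightarrow> vst_gen set" where
  "vst_gens n = Sg ` {1..n - 1} \<union> Tau ` {1..n - 1} \<union> Nu ` {1..n - 1}"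

inductive_set vst_rels :: "nat \<Rightarrow> (vst_gen list \<times> vst_gen list) set" for n :: nat where
  rel_s_s: "i \<in> {1..n - 1} \<Longrightarrow> ([Sg i, Sg i], []) \<in> vst_rels n"
| rel_nu_nu: "i \<in> {1..n - 1} \<Longrightarrow> ([Nu i, Nu i], []) \<in> vst_rels n"
| rel_tau_s: "i \<in> {1..n - 1} \<Longrightarrow> ([Tau i, Sg i], [Sg i, Tau i]) \<in> vst_rels n"
| rel_s_s_tau: "i \<in> {1..n - 1} \<Longrightarrow> j \<in> {1..n - 1} \<Longrightarrow> \<bar>int i - int j\<bar> = 1 \<Longrightarrow>
    ([Sg i, Sg j, Tau i], [Tau j, Sg i, Sg j]) \<in> vst_rels n"
| rel_nu_nu_nu: "i \<in> {1..n - 1} \<Longrightarrow> j \<in> {1..n - 1} \<Longrightarrow> \<bar>int i - int j\<bar> = 1 \<Longrightarrow>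
    ([Nu i, Nu j, Nu i], [Nu j, Nu i, Nu j]) \<in> vst_rels n"
| rel_nu_s_nu: "i \<in> {1..n - 1} \<Longrightarrow> j \<in> {1..n - 1} \<Longrightarrow> \<bar>int i - int j\<bar> = 1 \<Longrightarrow>
    ([Nu i, Sg j, Nu i], [Nu j, Sg i, Nu j]) \<in> vst_rels n"
| rel_nu_tau_nu: "i \<in> {1..n - 1} \<Longrightarrow> j \<in> {1..n - 1} \<Longrightarrow> \<bar>int i - int j\<bar> = 1 \<Longrightarrow>
    ([Nu i, Tau j, Nu i], [Nu j, Tau i, Nu j]) \<in> vst_rels n"
| rel_far: "i \<in> {1..n - 1} \<Longrightarrow> j \<in> {1..n - 1} \<Longrightarrow> \<bar>int i - int j\<bar> \<ge> 2 \<Longrightarrow>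
    g \<in> {Sg, Tau, Nu} \<Longrightarrow> h \<in> {Sg, Tau, Nu} \<Longrightarrow> ([g i, h j], [h j, g i]) \<in> vst_rels n"

definition VST :: "nat \<Rightarrow> (vst_gen \<times> bool) list set monoid" where
  "VST n = presented_group (vst_gens n) (vst_rels n)"

definition vst_elem :: "nat \<Rightarrow> vst_gen \<Rightarrow> (vst_gen \<times> bool) list set" where
  "vst_elem n x = pres_class (vst_gens n) (vst_rels n) (positive [x])"

text \<open>
  The ring of Laurent polynomials over the integers is the group ring of the infinite cyclic
  group: finitely supported functions from exponents to coefficients, multiplied by convolution.
\<close>

type_synonym laurent = "int \<Rightarrow>\<^sub>0 int"

definition tvar :: laurent where
  "tvar = Poly_Mapping.single 1 1"

definition GL_laurent :: "nat \<Rightarrow> laurent mat monoid" where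
  "GL_laurent n = units_of (ring_mat TYPE(laurent) n ())"

definition local_block :: "nat \<Rightarrow> nat \<Rightarrow> 'a \<Rightarrow> 'a \<Rightarrow> 'a \<Rightarrow> 'a \<Rightarrow> 'a :: {zero, one} mat" where
  "local_block n i a b c d =
    diag_block_mat [1\<^sub>m (i - 1), mat_of_rows_list 2 [[a, b], [c, d]], 1\<^sub>m (n - i - 1)]"

end

theory Submission
  imports Defs
begin

text \<open>
  The representation sends \<open>\<tau>\<^sub>1\<close> to the identity matrix, so it suffices that \<open>\<tau>\<^sub>1 \<noteq> 1\<close> in \<open>VST\<^sub>n\<close>.
  In each defining relation both sides contain the same number of letters \<open>\<tau>\<close>. Hence the total
  exponent of the letters \<open>\<tau>\<close> in a word depends only on its class, that is, it induces a
  homomorphism from \<open>VST\<^sub>n\<close> to the integers (\<open>vst_tau_exponent_invariant\<close>). It takes the value 1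
  on \<open>\<tau>\<^sub>1\<close> and 0 on the identity.
\<close>

definition exponent_sum :: "('g \<Rightarrow> int) \<Rightarrow> ('g \<times> bool) list \<Rightarrow> int" where
  "exponent_sum f w = (\<Sum>(x, b)\<leftarrow>w. if b then f x else - f x)"

text \<open>
  An assignment of integers to the generators extends to a homomorphism from the presented group
  to \<open>\<int>\<close> as soon as it respects the relations. On words, this extension is the exponent sum, and
  it cancels on \<open>x x\<^sup>-\<^sup>1\<close> by its signs.
\<close>

lemma exponent_sum_pres_cong:
  assumes "pres_cong X R u v"
    and rels: "\<And>p q. (p, q) \<in> R \<Longrightarrow> sum_list (map f p) = sum_list (map f q)"
  shows "exponent_sum f u = exponent_sum f v"
proof -
  have positive: "exponent_sum f (positive w) = sum_list (map f w)" for w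
    by (simp add: exponent_sum_def positive_def comp_def)
  from assms(1) show ?thesis
  proof (induction rule: pres_cong.induct)
    case (pres_relation p q)
    then show ?case by (simp add: positive rels)
  qed (simp_all add: exponent_sum_def)
qed

fun tau_degree :: "vst_gen \<Rightarrow> int" where
  "tau_degree (Tau i) = 1"
| "tau_degree (Sg i) = 0"
| "tau_degree (Nu i) = 0"

lemma vst_tau_exponent_invariant:
  assumes "pres_cong (vst_gens n) (vst_rels n) u v"
  shows "exponent_sum tau_degree u = exponent_sum tau_degree v"
proof (rule exponent_sum_pres_cong[OF assms])
  fix p q assume "(p, q) \<in> vst_rels n"
  then show "sum_list (map tau_degree p) = sum_list (map tau_degree q)"
    by (induction rule: vst_rels.induct) auto
qed

lemma vst_tau_nontrivial:
  assumes "i \<in> {1..n - 1}"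
  shows "vst_elem n (Tau i) \<noteq> \<one>\<^bsub>VST n\<^esub>"
proof
  assume "vst_elem n (Tau i) = \<one>\<^bsub>VST n\<^esub>"
  moreover have "[] \<in> pres_class (vst_gens n) (vst_rels n) []"
    by (simp add: pres_class_def pres_refl)
  ultimately have "pres_cong (vst_gens n) (vst_rels n) (positive [Tau i]) []"
    by (auto simp: vst_elem_def VST_def presented_group_def pres_class_def)
  from vst_tau_exponent_invariant[OF this] show False
    by (simp add: exponent_sum_def positive_def)
qed

lemma vst_elem_carrier:
  "x \<in> vst_gens n \<Longrightarrow> vst_elem n x \<in> carrier (VST n)"
  by (auto simp: vst_elem_def VST_def presented_group_def positive_def)

lemma group_GL_laurent: "group (GL_laurent n)"
proof -
  interpret R: semiring "ring_mat TYPE(laurent) n ()"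
    by (rule semiring_mat)
  show ?thesis
    unfolding GL_laurent_def by (rule R.units_group)
qed

lemma one_GL_laurent: "\<one>\<^bsub>GL_laurent n\<^esub> = 1\<^sub>m n"
  by (simp add: GL_laurent_def units_of_def ring_mat_def)

theorem proposition16:
  fixes n :: nat
    and v v_inv :: laurent
    and \<eta> :: "(vst_gen \<times> bool) list set \<Rightarrow> laurent mat"
  assumes "n \<ge> 3"
    and "v * v_inv = 1"
    and "\<eta> \<in> hom (VST n) (GL_laurent n)"
    and "\<And>i. i \<in> {1..n - 1} \<Longrightarrow>
      \<eta> (vst_elem n (Sg i)) = local_block n i (1 - tvar) tvar (2 - tvar) (tvar - 1)"
    and "\<And>i. i \<in> {1..n - 1} \<Longrightarrow> \<eta> (vst_elem n (Tau i)) = 1\<^sub>m n"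
    and "\<And>i. i \<in> {1..n - 1} \<Longrightarrow> \<eta> (vst_elem n (Nu i)) = local_block n i 0 v v_inv 0"
  shows "\<not> inj_on \<eta> (carrier (VST n))"
proof
  assume inj: "inj_on \<eta> (carrier (VST n))"
  have grp: "group (VST n)"
    unfolding VST_def by (rule presented_group_is_group)
  have i: "1 \<in> {1..n - 1}"
    using assms(1) by simp
  have "\<eta> (vst_elem n (Tau 1)) = 1\<^sub>m n"
    by (rule assms(5)[OF i])
  also have "\<dots> = \<eta> \<one>\<^bsub>VST n\<^esub>"
    using hom_one[OF assms(3) grp group_GL_laurent] by (simp add: one_GL_laurent)
  finally have "vst_elem n (Tau 1) = \<one>\<^bsub>VST n\<^esub>"
    by (rule inj_onD[OF inj])
      (use i in \<open>auto intro!: vst_elem_carrier monoid.one_closed group.is_monoid grp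
        simp: vst_gens_def\<close>)
  with vst_tau_nontrivial[OF i] show False by contradiction
qed

end
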